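(* Let $n_3,k\in\mathbb{N}$. If $k\ge 2$, then $P_3\square P_3\square P_{n_3}$ is equitably $k$-list arborable.
   Context: $P_n$ denotes the path on $n$ vertices and $\square$ the Cartesian product. A $k$-uniform list assignment $L$ for $G$ assigns to each vertex $v$ a set $L(v)$ of exactly $k$ colours; an $L$-colouring is a map $c$ with $c(v)\in L(v)$; it is equitable if every colour class has at most $\lceil |V(G)|/k\rceil$ vertices. $G$ is equitably $k$-list arborable if for every $k$-uniform list assignment $L$ there is an equitable $L$-colouring of $G$ in which every colour class induces an acyclic subgraph. *)

theory Defs
  imports Complex_Main
begin

type_synonym 'a ugraph = "'a set \<times> 'a set set"

abbreviation verts :: "'a ugraph \<Rightarrow> 'a set" where
  "verts G \<equiv> fst G"

abbreviation edges :: "'a ugraph \<Rightarrow> 'a set set" where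
  "edges G \<equiv> snd G"

definition simple_graph :: "'a ugraph \<Rightarrow> bool" where
  "simple_graph G \<longleftrightarrow> finite (verts G) \<and> (\<forall>e\<in>edges G. e \<subseteq> verts G \<and> card e = 2)"

definition path_graph :: "nat \<Rightarrow> nat ugraph" where
  "path_graph n = ({0..<n}, {{i, Suc i} | i. Suc i < n})"

definition cart_prod :: "'a ugraph \<Rightarrow> 'b ugraph \<Rightarrow> ('a \<times> 'b) ugraph" (infixl "\<box>" 70) where
  "G \<box> H =
    (verts G \<times> verts H,
     {{(u, x), (u, y)} | u x y. u \<in> verts G \<and> {x, y} \<in> edges H} \<union>
     {{(u, x), (v, x)} | u v x. {u, v} \<in> edges G \<and> x \<in> verts H})"

definition induced_subgraph :: "'a ugraph \<Rightarrow> 'a set \<Rightarrow> 'a ugraph" where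
  "induced_subgraph G S = (verts G \<inter> S, {e \<in> edges G. e \<subseteq> S})"

text \<open>A cycle is listed without repeating its first vertex; the index modulo the length
  supplies the closing edge.\<close>

definition is_cycle :: "'a ugraph \<Rightarrow> 'a list \<Rightarrow> bool" where
  "is_cycle G vs \<longleftrightarrow>
    3 \<le> length vs \<and> distinct vs \<and> set vs \<subseteq> verts G \<and>
    (\<forall>i < length vs. {vs ! i, vs ! (Suc i mod length vs)} \<in> edges G)"

definition acyclic_graph :: "'a ugraph \<Rightarrow> bool" where
  "acyclic_graph G \<longleftrightarrow> (\<nexists>vs. is_cycle G vs)"

text \<open>Assignments and colourings are total functions whose values outside the vertex set
  are irrelevant.\<close>

definition uniform_list_assignment :: "nat \<Rightarrow> 'a ugraph \<Rightarrow> ('a \<Rightarrow> 'c set) \<Rightarrow> bool" where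
  "uniform_list_assignment k G L \<longleftrightarrow> (\<forall>v\<in>verts G. finite (L v) \<and> card (L v) = k)"

definition list_colouring :: "'a ugraph \<Rightarrow> ('a \<Rightarrow> 'c set) \<Rightarrow> ('a \<Rightarrow> 'c) \<Rightarrow> bool" where
  "list_colouring G L c \<longleftrightarrow> (\<forall>v\<in>verts G. c v \<in> L v)"

definition colour_class :: "'a ugraph \<Rightarrow> ('a \<Rightarrow> 'c) \<Rightarrow> 'c \<Rightarrow> 'a set" where
  "colour_class G c a = {v \<in> verts G. c v = a}"

definition equitable :: "nat \<Rightarrow> 'a ugraph \<Rightarrow> ('a \<Rightarrow> 'c) \<Rightarrow> bool" where
  "equitable k G c \<longleftrightarrow>
    (\<forall>a. int (card (colour_class G c a)) \<le> \<lceil>real (card (verts G)) / real k\<rceil>)"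

text \<open>The type of colours is a parameter, as a definition cannot quantify over types; results
  about equitable list arborability should keep \<open>'c\<close> arbitrary.\<close>

definition equitably_list_arborable :: "'c itself \<Rightarrow> nat \<Rightarrow> 'a ugraph \<Rightarrow> bool" where
  "equitably_list_arborable (T :: 'c itself) k G \<longleftrightarrow>
    (\<forall>L :: 'a \<Rightarrow> 'c set. uniform_list_assignment k G L \<longrightarrow>
      (\<exists>c. list_colouring G L c \<and> equitable k G c \<and>
        (\<forall>a. acyclic_graph (induced_subgraph G (colour_class G c a)))))"

lemma simple_graph_path_graph: "simple_graph (path_graph n)"
  by (auto simp: simple_graph_def path_graph_def)

lemma simple_graph_cart_prod:
  assumes "simple_graph G" "simple_graph H"
  shows "simple_graph (G \<box> H)"
proof -
  have neq: "x \<noteq> y" if "card {x, y} = 2" for x y :: 'd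
    using that by auto
  show ?thesis
    using assms by (fastforce simp: simple_graph_def cart_prod_def card_insert_if dest: neq)
qed

end

theory Submission
  imports Defs
begin

text \<open>For \<open>k \<ge> 3\<close> the grid is coloured in blocks of at most \<open>k\<close> vertices, the vertices of a block receiving
  distinct colours. If the \<open>i\<close>-th vertex of a block (counted from \<open>0\<close>) has at most \<open>2 * i + 1\<close> neighbours
  coloured earlier, at most \<open>i\<close> colours occur twice among them, so the block can be coloured greedily,
  its last vertex first, without closing a monochromatic cycle. Lexicographic order gives such
  blocks for \<open>k \<ge> 4\<close>; for \<open>k = 3\<close> each layer splits into three of them.

  For \<open>k = 2\<close> no such blocks exist. Instead, each layer minus its centre is tiled by four dominoes that
  are made bichromatic, and the column of centres is properly coloured. This gives equitability and
  rules out cycles within a layer. Proceeding upwards, the colours of a layer are chosen so that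
  every monochromatic component inside it is attached to the layer below by at most one edge.\<close>

section \<open>Monochromatic cores as obstructions to acyclic colour classes\<close>

text \<open>Sets inducing minimum degree at least two take the place of cycles, which sit inside them.\<close>

definition core :: "'a set set \<Rightarrow> 'a set \<Rightarrow> bool" where
  "core E C \<longleftrightarrow> C \<noteq> {} \<and> (\<forall>v\<in>C. \<exists>x\<in>C. \<exists>y\<in>C. x \<noteq> y \<and> {v, x} \<in> E \<and> {v, y} \<in> E)"

definition forest_colouring :: "'a set set \<Rightarrow> 'a set \<Rightarrow> ('a \<Rightarrow> 'c) \<Rightarrow> bool" where
  "forest_colouring E W c \<longleftrightarrow> (\<forall>C a. C \<subseteq> W \<longrightarrow> core E C \<longrightarrow> \<not> (\<forall>v\<in>C. c v = a))"

text \<open>\<open>E\<close> stays the edge set of the whole graph while \<open>W\<close> grows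
  during the inductions, so no subgraphs have to be compared.\<close>

definition capped_colouring ::
    "'a set set \<Rightarrow> ('a \<Rightarrow> 'c set) \<Rightarrow> 'a set \<Rightarrow> nat \<Rightarrow> ('a \<Rightarrow> 'c) \<Rightarrow> bool" where
  "capped_colouring E L W m c \<longleftrightarrow>
    (\<forall>v\<in>W. c v \<in> L v) \<and> (\<forall>a. card {v \<in> W. c v = a} \<le> m) \<and> forest_colouring E W c"

lemma core_mono:
  assumes "E \<subseteq> E'" "core E C"
  shows "core E' C"
  using assms unfolding core_def by (meson subsetD)

text \<open>The two cyclic neighbours of a vertex serve as witnesses; length at least three makes
  them different.\<close>

lemma core_if_cycle:
  assumes "is_cycle G vs"
  shows "core (edges G) (set vs)"
proof -
  let ?l = "length vs"
  have l: "3 \<le> ?l" and d: "distinct vs"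
    and e: "\<And>i. i < ?l \<Longrightarrow> {vs ! i, vs ! (Suc i mod ?l)} \<in> edges G"
    using assms by (auto simp: is_cycle_def)
  have "\<exists>x\<in>set vs. \<exists>y\<in>set vs. x \<noteq> y \<and> {v, x} \<in> edges G \<and> {v, y} \<in> edges G"
    if "v \<in> set vs" for v
  proof -
    obtain i where i: "i < ?l" "v = vs ! i"
      using \<open>v \<in> set vs\<close> by (metis in_set_conv_nth)
    \<comment> \<open>The cyclic predecessor of \<open>i\<close>; the case split avoids truncated
      subtraction at \<open>0\<close>.\<close>
    define j where "j = (if i = 0 then ?l - 1 else i - 1)"
    have j: "j < ?l" "Suc j mod ?l = i"
      using i(1) l by (auto simp: j_def)
    have si: "Suc i mod ?l \<noteq> j" "Suc i mod ?l < ?l"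
      using i(1) l by (auto simp: j_def mod_Suc)
    then have "vs ! (Suc i mod ?l) \<noteq> vs ! j"
      using d j by (simp add: nth_eq_iff_index_eq)
    moreover have "{v, vs ! j} \<in> edges G"
      using e[OF j(1)] unfolding j(2) i(2) by (simp add: insert_commute)
    moreover have "{v, vs ! (Suc i mod ?l)} \<in> edges G"
      using e[OF i(1)] unfolding i(2) .
    ultimately show ?thesis
      using nth_mem[OF j(1)] nth_mem[OF si(2)] by blast
  qed
  moreover have "set vs \<noteq> {}"
    using l by auto
  ultimately show ?thesis
    unfolding core_def by blast
qed

lemma acyclic_colour_class:
  assumes "forest_colouring (edges G) (verts G) c"
  shows "acyclic_graph (induced_subgraph G (colour_class G c a))"
  unfolding acyclic_graph_def
proof
  assume "\<exists>vs. is_cycle (induced_subgraph G (colour_class G c a)) vs"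
  then obtain vs where vs: "is_cycle (induced_subgraph G (colour_class G c a)) vs" ..
  have "edges (induced_subgraph G (colour_class G c a)) \<subseteq> edges G"
    by (auto simp: induced_subgraph_def)
  then have "core (edges G) (set vs)"
    using core_if_cycle[OF vs] by (rule core_mono)
  moreover have "set vs \<subseteq> colour_class G c a"
    using vs by (simp add: is_cycle_def induced_subgraph_def)
  then have "set vs \<subseteq> verts G" "\<forall>v\<in>set vs. c v = a"
    by (auto simp: colour_class_def)
  ultimately show False
    using assms unfolding forest_colouring_def by metis
qed

lemma equitably_list_arborableI:
  assumes "\<And>L :: 'a \<Rightarrow> 'c set. uniform_list_assignment k G L \<Longrightarrow>
    \<exists>c. capped_colouring (edges G) L (verts G) m c"
    and "int m \<le> \<lceil>real (card (verts G)) / real k\<rceil>"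
  shows "equitably_list_arborable TYPE('c) k G"
  unfolding equitably_list_arborable_def
proof (intro allI impI)
  fix L :: "'a \<Rightarrow> 'c set"
  assume "uniform_list_assignment k G L"
  then obtain c where c: "capped_colouring (edges G) L (verts G) m c"
    using assms(1) by blast
  then have "list_colouring G L c"
    by (simp add: capped_colouring_def list_colouring_def)
  moreover have "equitable k G c"
    unfolding equitable_def
  proof
    fix a
    have "card (colour_class G c a) \<le> m"
      using c by (simp add: capped_colouring_def colour_class_def)
    then show "int (card (colour_class G c a)) \<le> \<lceil>real (card (verts G)) / real k\<rceil>"
      using assms(2) by linarith
  qed
  moreover have "acyclic_graph (induced_subgraph G (colour_class G c a))" for a
    using c by (intro acyclic_colour_class) (simp add: capped_colouring_def)
  ultimately show "\<exists>c. list_colouring G L c \<and> equitable k G c \<and>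
      (\<forall>a. acyclic_graph (induced_subgraph G (colour_class G c a)))"
    by blast
qed

section \<open>Extending a colouring by a block of distinctly coloured vertices\<close>

text \<open>Greedy choice from the last vertex to the first: \<open>U\<close> collects the colours
  already spent. When the vertex at position \<open>i\<close> is reached, at most \<open>i\<close>
  colours are forbidden by \<open>F\<close>, and together with \<open>U\<close> they number fewer
  than \<open>k\<close>.\<close>

lemma distinct_representatives:
  assumes "distinct xs" "finite U" "card U + length xs \<le> k"
    and "\<And>v. v \<in> set xs \<Longrightarrow> finite (L v) \<and> card (L v) = k"
    and "\<And>i. i < length xs \<Longrightarrow> finite (F (xs ! i)) \<and> card (F (xs ! i)) \<le> i"
  shows "\<exists>d. inj_on d (set xs) \<and> (\<forall>v\<in>set xs. d v \<in> L v - F v - U)"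
  using assms
proof (induction xs arbitrary: U rule: rev_induct)
  case Nil
  then show ?case by simp
next
  case (snoc x xs)
  have Fx: "finite (F x)" "card (F x) \<le> length xs"
    using snoc.prems(5)[of "length xs"] by auto
  have "card (F x \<union> U) < card (L x)"
    using snoc.prems(3) snoc.prems(4)[of x] Fx card_Un_le[of "F x" U] by auto
  then have "\<not> L x \<subseteq> F x \<union> U"
    using Fx snoc.prems(2) card_mono[of "F x \<union> U" "L x"] by auto
  then obtain b where b: "b \<in> L x" "b \<notin> F x" "b \<notin> U"
    by auto
  have "\<exists>d. inj_on d (set xs) \<and> (\<forall>v\<in>set xs. d v \<in> L v - F v - insert b U)"
  proof (rule snoc.IH)
    show "finite (F (xs ! i)) \<and> card (F (xs ! i)) \<le> i" if "i < length xs" for i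
      using snoc.prems(5)[of i] that by (simp add: nth_append)
  qed (use snoc.prems b in auto)
  then obtain d where d: "inj_on d (set xs)" "\<forall>v\<in>set xs. d v \<in> L v - F v - insert b U"
    by blast
  have "x \<notin> set xs"
    using snoc.prems(1) by auto
  then have "inj_on (d(x := b)) (set (xs @ [x])) \<and>
      (\<forall>v\<in>set (xs @ [x]). (d(x := b)) v \<in> L v - F v - U)"
    using d b by (auto simp: inj_on_def)
  then show ?case by blast
qed

text \<open>The colour classes inside \<open>N\<close> are disjoint, and each repeated colour uses
  up at least two elements. Hence \<open>2 * i + 1\<close> neighbours repeat at most
  \<open>i\<close> colours.\<close>

lemma card_repeated_colours:
  assumes "finite N"
  shows "finite {a. \<exists>x\<in>N. \<exists>y\<in>N. x \<noteq> y \<and> c x = a \<and> c y = a}" (is "finite ?A")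
    and "2 * card {a. \<exists>x\<in>N. \<exists>y\<in>N. x \<noteq> y \<and> c x = a \<and> c y = a} \<le> card N"
proof -
  have "?A \<subseteq> c ` N" by auto
  then show fin: "finite ?A"
    using assms finite_subset by blast
  have two: "2 \<le> card {x \<in> N. c x = a}" if "a \<in> ?A" for a
  proof -
    obtain x y where "x \<in> N" "y \<in> N" "x \<noteq> y" "c x = a" "c y = a"
      using \<open>a \<in> ?A\<close> by blast
    then have "card {x, y} \<le> card {x \<in> N. c x = a}"
      using assms by (intro card_mono) auto
    then show ?thesis using \<open>x \<noteq> y\<close> by simp
  qed
  have "2 * card ?A \<le> (\<Sum>a\<in>?A. card {x \<in> N. c x = a})"
    using sum_bounded_below[of ?A 2 "\<lambda>a. card {x \<in> N. c x = a}"] two by (simp add: mult.commute)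
  also have "\<dots> = card (\<Union>a\<in>?A. {x \<in> N. c x = a})"
    using assms fin by (intro card_UN_disjoint[symmetric]) auto
  also have "\<dots> \<le> card N"
    using assms by (intro card_mono) auto
  finally show "2 * card ?A \<le> card N" .
qed

text \<open>Distinct colours on the block let each class grow by at most one. They also let a
  monochromatic core contain only one block vertex, whose two neighbours in the core then lie in
  \<open>W\<close> and share its colour.\<close>

lemma extend_by_block:
  assumes c: "capped_colouring E L W m c"
    and W: "finite W" "set xs \<inter> W = {}"
    and xs: "distinct xs" "length xs \<le> k"
    and L: "\<And>v. v \<in> set xs \<Longrightarrow> finite (L v) \<and> card (L v) = k"
    and loop: "\<And>v. {v} \<notin> E"
    and nbrs: "\<And>i. i < length xs \<Longrightarrow> card {w \<in> W. {xs ! i, w} \<in> E} \<le> 2 * i + 1"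
  shows "\<exists>c. capped_colouring E L (W \<union> set xs) (Suc m) c"
proof -
  define N where "N v = {w \<in> W. {v, w} \<in> E}" for v
  \<comment> \<open>The colours that would give \<open>v\<close> two neighbours of its own colour in
    \<open>W\<close>.\<close>
  define F where "F v = {a. \<exists>x\<in>N v. \<exists>y\<in>N v. x \<noteq> y \<and> c x = a \<and> c y = a}" for v
  have "\<exists>d. inj_on d (set xs) \<and> (\<forall>v\<in>set xs. d v \<in> L v - F v - {})"
  proof (rule distinct_representatives)
    fix i assume i: "i < length xs"
    have "finite (N (xs ! i))"
      using W by (simp add: N_def)
    from card_repeated_colours[OF this, of c] nbrs[OF i]
    show "finite (F (xs ! i)) \<and> card (F (xs ! i)) \<le> i"
      unfolding F_def N_def by linarith
  qed (use xs L in auto)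
  then obtain d where inj: "inj_on d (set xs)" and d: "\<forall>v\<in>set xs. d v \<in> L v - F v"
    by auto
  define c' where "c' v = (if v \<in> set xs then d v else c v)" for v
  have cW: "c' v = c v" if "v \<in> W" for v
    using that W by (auto simp: c'_def)
  have "card {v \<in> W \<union> set xs. c' v = a} \<le> Suc m" for a
  proof -
    have eq: "{v \<in> W \<union> set xs. c' v = a} = {v \<in> W. c v = a} \<union> {v \<in> set xs. d v = a}"
      using W(2) by (auto simp: c'_def)
    have "card {v \<in> set xs. d v = a} \<le> 1"
      using inj by (auto simp: card_le_Suc0_iff_eq inj_on_def)
    moreover have "card {v \<in> W. c v = a} \<le> m"
      using c by (simp add: capped_colouring_def)
    ultimately show ?thesis
      unfolding eq using card_Un_le[of "{v \<in> W. c v = a}" "{v \<in> set xs. d v = a}"] by linarith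
  qed
  moreover have "forest_colouring E (W \<union> set xs) c'"
    unfolding forest_colouring_def
  proof (intro allI impI notI)
    fix C a assume C: "C \<subseteq> W \<union> set xs" "core E C" "\<forall>v\<in>C. c' v = a"
    show False
    proof (cases "C \<subseteq> W")
      case True
      then have "\<forall>v\<in>C. c v = a"
        using C(3) cW by (metis subsetD)
      then show False
        using c C(2) True by (auto simp: capped_colouring_def forest_colouring_def)
    next
      case False
      then obtain x where x: "x \<in> C" "x \<in> set xs"
        using C(1) by auto
      have uniq: "v = x" if "v \<in> C" "v \<in> set xs" for v
        using that x C(3) inj by (metis c'_def inj_onD)
      obtain y z where yz: "y \<in> C" "z \<in> C" "y \<noteq> z" "{x, y} \<in> E" "{x, z} \<in> E"
        using C(2) x unfolding core_def by meson
      have "y \<noteq> x" "z \<noteq> x"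
        using yz(4,5) loop[of x] by (metis insert_absorb2)+
      then have W: "y \<in> W" "z \<in> W"
        using uniq yz(1,2) C(1) by blast+
      then have "y \<in> N x" "z \<in> N x"
        using yz(4,5) by (simp_all add: N_def)
      moreover have "c y = a" "c z = a"
        using W C(3) yz(1,2) by (simp_all flip: cW)
      ultimately have "a \<in> F x"
        using yz(3) by (auto simp: F_def)
      moreover have "d x = a"
        using x C(3) by (auto simp: c'_def)
      ultimately show False
        using d x by auto
    qed
  qed
  moreover have "\<forall>v\<in>W \<union> set xs. c' v \<in> L v"
    using c d by (auto simp: c'_def capped_colouring_def)
  ultimately show ?thesis
    unfolding capped_colouring_def by blast
qed

section \<open>The grid\<close>

definition grid :: "nat \<Rightarrow> ((nat \<times> nat) \<times> nat) ugraph" where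
  "grid n = path_graph 3 \<box> path_graph 3 \<box> path_graph n"

lemma verts_cart_prod: "verts (G \<box> H) = verts G \<times> verts H"
  by (simp add: cart_prod_def)

lemma verts_path_graph: "verts (path_graph n) = {0..<n}"
  by (simp add: path_graph_def)

lemma verts_grid: "verts (grid n) = ({0..<3} \<times> {0..<3}) \<times> {0..<n}"
  by (simp add: grid_def verts_cart_prod verts_path_graph)

lemma verts_grid_Suc:
  "verts (grid (Suc n)) = verts (grid n) \<union> ({0..<3} \<times> {0..<3}) \<times> {n}"
  unfolding verts_grid by (auto simp: less_Suc_eq)

lemma edge_path_graph_iff:
  "{i, j} \<in> edges (path_graph n) \<longleftrightarrow> i < n \<and> j < n \<and> (j = Suc i \<or> i = Suc j)"
  by (auto simp: path_graph_def doubleton_eq_iff)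

lemma edge_cart_prod_iff:
  "{(u, x), (v, y)} \<in> edges (G \<box> H) \<longleftrightarrow>
    u = v \<and> u \<in> verts G \<and> {x, y} \<in> edges H \<or> x = y \<and> x \<in> verts H \<and> {u, v} \<in> edges G"
    (is "?l \<longleftrightarrow> ?r")
proof
  assume ?l
  then consider (snd) w a b where "{(u, x), (v, y)} = {(w, a), (w, b)}" "w \<in> verts G" "{a, b} \<in> edges H"
    | (fst) w w' a where "{(u, x), (v, y)} = {(w, a), (w', a)}" "a \<in> verts H" "{w, w'} \<in> edges G"
    by (auto simp: cart_prod_def)
  then show ?r
    by cases (auto simp: doubleton_eq_iff insert_commute)
next
  assume ?r
  then show ?l
    unfolding cart_prod_def by auto
qed

lemma edge_grid_iff:
  "{((x, y), z), ((x', y'), z')} \<in> edges (grid n) \<longleftrightarrow>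
    x < 3 \<and> y < 3 \<and> z < n \<and> x' < 3 \<and> y' < 3 \<and> z' < n \<and>
    (x = x' \<and> y = y' \<and> (z' = Suc z \<or> z = Suc z') \<or>
     z = z' \<and> x = x' \<and> (y' = Suc y \<or> y = Suc y') \<or>
     z = z' \<and> y = y' \<and> (x' = Suc x \<or> x = Suc x'))"
  unfolding grid_def edge_cart_prod_iff edge_path_graph_iff verts_cart_prod verts_path_graph
  by auto

lemma no_loop_grid: "{v} \<notin> edges (grid n)"
proof -
  obtain x y z where "v = ((x, y), z)"
    by (metis prod.exhaust)
  then show ?thesis
    using edge_grid_iff[of x y z x y z n] by simp
qed

lemma card_verts_grid: "card (verts (grid n)) = 9 * n"
  by (simp add: verts_grid card_cartesian_product)

lemma lists_grid_mono:
  assumes "uniform_list_assignment k (grid n) L" "z \<le> n" "v \<in> verts (grid z)"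
  shows "finite (L v) \<and> card (L v) = k"
  using assms by (auto simp: uniform_list_assignment_def verts_grid)

lemma card_le_length: "A \<subseteq> set ws \<Longrightarrow> card A \<le> length ws"
  by (meson card_length card_mono finite_set le_trans)

text \<open>The first vertex of each block has at most one earlier neighbour and the others at most
  three, which suffices because \<open>2 * i + 1\<close> is at least 3 once \<open>i\<close> is
  positive.\<close>

lemma card_block_bound:
  assumes "A \<subseteq> set (w # (if i = 0 then [] else [x, y]))"
  shows "card A \<le> 2 * i + 1"
  using card_le_length[OF assms] by (cases "i = 0") (simp_all del: One_nat_def)

lemma capped_colouring_empty: "capped_colouring E L {} 0 c"
  by (simp add: capped_colouring_def forest_colouring_def core_def)

lemma atLeastLessThan_3: "{0..<3 :: nat} = {0, 1, 2}"
  by auto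

section \<open>Lists of size three\<close>

lemma capped_colouring_3:
  assumes L: "uniform_list_assignment 3 (grid n) L"
  shows "z \<le> n \<Longrightarrow> \<exists>c. capped_colouring (edges (grid n)) L (verts (grid z)) (3 * z) c"
proof (induction z)
  case 0
  then show ?case
    using capped_colouring_empty by (auto simp: verts_grid)
next
  case (Suc z)
  let ?E = "edges (grid n)" and ?W = "verts (grid z)"
  \<comment> \<open>A side of the square, a bent path and a corner with its two neighbours. Each
    block starts with a vertex whose neighbours in the layer lie in the same block or come later, so
    only the vertex below it is already coloured.\<close>
  define b1 b2 b3 :: "((nat \<times> nat) \<times> nat) list" where
    b: "b1 = [((2, 0), z), ((2, 1), z), ((2, 2), z)]"
      "b2 = [((0, 2), z), ((1, 2), z), ((1, 1), z)]"
      "b3 = [((0, 0), z), ((0, 1), z), ((1, 0), z)]"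
  have lt3: "i = 0 \<or> i = 1 \<or> i = 2" if "i < length [u, v, w]" for i :: nat and u v w :: "(nat \<times> nat) \<times> nat"
    using that by auto
  have L': "finite (L v) \<and> card (L v) = 3" if "v \<in> set b1 \<union> set b2 \<union> set b3" for v
    by (rule lists_grid_mono[OF L Suc.prems]) (use that in \<open>auto simp: b verts_grid\<close>)
  obtain c0 where c0: "capped_colouring ?E L ?W (3 * z) c0"
    using Suc by auto
  have "\<exists>c. capped_colouring ?E L (?W \<union> set b1) (Suc (3 * z)) c"
  proof (rule extend_by_block[OF c0 _ _ _ _ _ no_loop_grid])
    fix i assume "i < length b1"
    \<comment> \<open>For \<open>z = 0\<close> the truncated \<open>z - 1\<close> names no vertex
      below, which is harmless in an upper bound.\<close>
    have "{w \<in> ?W. {b1 ! i, w} \<in> ?E} \<subseteq> set [(fst (b1 ! i), z - 1)]"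
      using lt3[OF \<open>i < length b1\<close>[unfolded b]] by (auto simp: b verts_grid edge_grid_iff)
    from card_le_length[OF this] show "card {w \<in> ?W. {b1 ! i, w} \<in> ?E} \<le> 2 * i + 1"
      by simp
  next
    show "finite (L v) \<and> card (L v) = 3" if "v \<in> set b1" for v
      by (rule L') (simp add: that)
  qed (simp_all add: b verts_grid)
  then obtain c1 where c1: "capped_colouring ?E L (?W \<union> set b1) (Suc (3 * z)) c1" ..
  have "\<exists>c. capped_colouring ?E L (?W \<union> set b1 \<union> set b2) (Suc (Suc (3 * z))) c"
  proof (rule extend_by_block[OF c1 _ _ _ _ _ no_loop_grid])
    fix i assume i: "i < length b2"
    let ?N = "{w \<in> ?W \<union> set b1. {b2 ! i, w} \<in> ?E}"
    have "?N \<subseteq> set ((fst (b2 ! i), z - 1) # (if i = 0 then [] else [((2, 1), z), ((2, 2), z)]))"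
      using lt3[OF i[unfolded b]] by (auto simp: b verts_grid edge_grid_iff)
    then show "card ?N \<le> 2 * i + 1"
      by (rule card_block_bound)
  next
    show "finite (L v) \<and> card (L v) = 3" if "v \<in> set b2" for v
      by (rule L') (simp add: that)
  qed (simp_all add: b verts_grid)
  then obtain c2 where c2: "capped_colouring ?E L (?W \<union> set b1 \<union> set b2) (Suc (Suc (3 * z))) c2" ..
  have "\<exists>c. capped_colouring ?E L (?W \<union> set b1 \<union> set b2 \<union> set b3) (Suc (Suc (Suc (3 * z)))) c"
  proof (rule extend_by_block[OF c2 _ _ _ _ _ no_loop_grid])
    fix i assume i: "i < length b3"
    let ?N = "{w \<in> ?W \<union> set b1 \<union> set b2. {b3 ! i, w} \<in> ?E}"
    have "?N \<subseteq> set ((fst (b3 ! i), z - 1) # (if i = 0 then [] else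
        [((1, 1), z), if i = 1 then ((0, 2), z) else ((2, 0), z)]))"
      using lt3[OF i[unfolded b]] by (auto simp: b verts_grid edge_grid_iff)
    then show "card ?N \<le> 2 * i + 1"
      by (rule card_block_bound)
  next
    show "finite (L v) \<and> card (L v) = 3" if "v \<in> set b3" for v
      by (rule L') (simp add: that)
  qed (simp_all add: b verts_grid)
  moreover have "({0..<3} \<times> {0..<3}) \<times> {z} = set b1 \<union> set b2 \<union> set b3"
    unfolding atLeastLessThan_3 b by auto
  then have "?W \<union> set b1 \<union> set b2 \<union> set b3 = verts (grid (Suc z))"
    by (simp add: verts_grid_Suc Un_assoc)
  ultimately show ?case
    by (simp add: numeral_3_eq_3)
qed

section \<open>Lists of size at least four\<close>

fun lex_index :: "(nat \<times> nat) \<times> nat \<Rightarrow> nat" where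
  "lex_index ((x, y), z) = 9 * z + 3 * y + x"

definition lex_point :: "nat \<Rightarrow> (nat \<times> nat) \<times> nat" where
  "lex_point t = ((t mod 3, t div 3 mod 3), t div 9)"

lemma lex_index_point: "lex_index (lex_point t) = t"
proof -
  have "t div 9 = t div 3 div 3"
    by (simp flip: div_mult2_eq)
  then show ?thesis
    using div_mult_mod_eq[of t 3] div_mult_mod_eq[of "t div 3" 3]
    unfolding lex_point_def lex_index.simps by linarith
qed

lemma lex_point_inject: "lex_point s = lex_point t \<longleftrightarrow> s = t"
  by (metis lex_index_point)

lemma verts_grid_lex: "verts (grid n) = lex_point ` {..<9 * n}"
proof
  show "lex_point ` {..<9 * n} \<subseteq> verts (grid n)"
    by (auto simp: lex_point_def verts_grid)
  show "verts (grid n) \<subseteq> lex_point ` {..<9 * n}"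
  proof
    fix v assume "v \<in> verts (grid n)"
    then obtain x y z where v: "v = ((x, y), z)" "x < 3" "y < 3" "z < n"
      by (auto simp: verts_grid)
    define u where "u = y + 3 * z"
    define t where "t = x + 3 * u"
    have u: "u mod 3 = y" "u div 3 = z"
      using v(3) by (simp_all add: u_def)
    have t: "t mod 3 = x" "t div 3 = u"
      using v(2) by (simp_all add: t_def)
    have "t div 9 = z"
      using u(2) t(2) div_mult2_eq[of t 3 3] by simp
    then have "v = lex_point t"
      by (simp add: v(1) lex_point_def u t)
    moreover have "t < 9 * n"
      using v(2-4) by (simp add: t_def u_def)
    ultimately show "v \<in> lex_point ` {..<9 * n}"
      by auto
  qed
qed

text \<open>A unit step back in the first, second or third coordinate lowers the index by 1, 3 or
  9.\<close>

lemma edge_lex_point: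
  assumes "{lex_point t, lex_point s} \<in> edges (grid n)" "s < t"
  shows "s = t - 1 \<or> s = t - 3 \<or> s = t - 9"
proof -
  obtain x y z x' y' z' where eq: "lex_point t = ((x, y), z)" "lex_point s = ((x', y'), z')"
    by (metis prod.exhaust)
  then have "t = 9 * z + 3 * y + x" "s = 9 * z' + 3 * y' + x'"
    by (metis lex_index.simps lex_index_point)+
  then show ?thesis
    using assms unfolding eq edge_grid_iff by auto
qed

text \<open>Strong induction removes the last \<open>k\<close> points, or all of them if fewer
  remain; the cap is the ceiling of \<open>s / k\<close>. As \<open>k\<close> is at least 4, the
  predecessors of the last point at distances 1 and 3 fall into its own block, leaving only the one
  at distance 9.\<close>

lemma capped_colouring_ge_4:
  assumes L: "uniform_list_assignment k (grid n) L" and k: "4 \<le> k"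
  shows "s \<le> 9 * n \<Longrightarrow>
    \<exists>c. capped_colouring (edges (grid n)) L (lex_point ` {..<s}) ((s + k - 1) div k) c"
proof (induction s rule: less_induct)
  case (less s)
  let ?E = "edges (grid n)" and ?W = "lex_point ` {..<s - k}"
  show ?case
  proof (cases "s = 0")
    case True
    then show ?thesis
      using capped_colouring_empty k by auto
  next
    case False
    \<comment> \<open>Reversed, because the last point has the fewest neighbours outside the block
      and must come first.\<close>
    define xs where "xs = map lex_point (rev [s - k..<s])"
    obtain c where c: "capped_colouring ?E L ?W ((s - k + k - 1) div k) c"
      using less.IH[of "s - k"] less.prems False k by force
    have "\<exists>c. capped_colouring ?E L (?W \<union> set xs) (Suc ((s - k + k - 1) div k)) c"
    proof (rule extend_by_block[OF c])
      fix i assume i: "i < length xs"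
      then have i': "i < s" "i < k" and xi: "xs ! i = lex_point (s - 1 - i)"
        by (auto simp: xs_def rev_nth)
      let ?N = "{w \<in> ?W. {xs ! i, w} \<in> ?E}"
      have "?N \<subseteq> set (lex_point (s - 1 - i - 9) # (if i = 0 then [] else
          [lex_point (s - 1 - i - 1), lex_point (s - 1 - i - 3)]))"
      proof
        fix w assume "w \<in> ?N"
        then obtain t where t: "w = lex_point t" "t < s - k" "{xs ! i, w} \<in> ?E"
          by auto
        then have "t = s - 1 - i - 1 \<or> t = s - 1 - i - 3 \<or> t = s - 1 - i - 9"
          using edge_lex_point[of "s - 1 - i" t n] i' by (simp add: xi)
        then show "w \<in> set (lex_point (s - 1 - i - 9) # (if i = 0 then [] else
          [lex_point (s - 1 - i - 1), lex_point (s - 1 - i - 3)]))"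
          using t(1,2) k by auto
      qed
      then show "card ?N \<le> 2 * i + 1"
        by (rule card_block_bound)
    next
      fix v assume "v \<in> set xs"
      then have "v \<in> verts (grid n)"
        using less.prems by (auto simp: xs_def verts_grid_lex)
      then show "finite (L v) \<and> card (L v) = k"
        using L by (auto simp: uniform_list_assignment_def)
    qed (use no_loop_grid in \<open>auto simp: xs_def lex_point_inject distinct_map inj_on_def\<close>)
    moreover have "{..<s - k} \<union> {s - k..<s} = {..<s}"
      by auto
    then have "?W \<union> set xs = lex_point ` {..<s}"
      by (simp add: xs_def flip: image_Un)
    moreover have "Suc ((s - k + k - 1) div k) = (s + k - 1) div k"
    proof (cases "k \<le> s")
      case True
      then have "s - k + k - 1 = s - 1" "s + k - 1 = (s - 1) + k"
        using False by auto
      then show ?thesis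
        using k by (simp only: div_add_self2 Suc_eq_plus1)
    next
      case False
      then have "s + k - 1 = (s - 1) + k" "s - 1 < k" "s - k + k - 1 < k"
        using \<open>s \<noteq> 0\<close> k by auto
      then show ?thesis
        using k by (simp only: div_add_self2 div_less Suc_eq_plus1)
    qed
    ultimately show ?thesis by simp
  qed
qed

section \<open>Lists of size two\<close>

text \<open>Every layer minus its centre is tiled by four dominoes, the \<open>i\<close>-th consisting of \<open>corner i\<close>
  and \<open>mid i\<close> in cyclic order around the boundary. Each unit square contains a domino.\<close>

definition corner :: "nat \<Rightarrow> nat \<times> nat" where
  "corner i = [(0, 0), (0, 2), (2, 2), (2, 0)] ! i"

definition mid :: "nat \<Rightarrow> nat \<times> nat" where
  "mid i = [(0, 1), (1, 2), (2, 1), (1, 0)] ! i"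

text \<open>\<open>corner (next_domino i)\<close> follows \<open>mid i\<close> on the boundary
  cycle; the two are adjacent but belong to different dominoes.\<close>

abbreviation next_domino :: "nat \<Rightarrow> nat" where
  "next_domino i \<equiv> Suc i mod 4"

lemma less_4_cases: "i < (4 :: nat) \<longleftrightarrow> i = 0 \<or> i = 1 \<or> i = 2 \<or> i = 3"
  by auto

lemma ex_less_4: "(\<exists>i<4 :: nat. P i) \<longleftrightarrow> P 0 \<or> P 1 \<or> P 2 \<or> P 3"
  by (auto simp: less_4_cases)

text \<open>Corners are indexed through \<open>next_domino\<close> because a corner will be treated
  together with the mid preceding it.\<close>

lemma square_cases:
  assumes "x < 3" "y < 3"
  shows "(x, y) = (1, 1) \<or> (\<exists>i<4. (x, y) = corner (next_domino i)) \<or> (\<exists>i<4. (x, y) = mid i)"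
proof -
  have "x = 0 \<or> x = 1 \<or> x = 2" "y = 0 \<or> y = 1 \<or> y = 2"
    using assms by auto
  then show ?thesis
    unfolding ex_less_4 by (elim disjE) (simp_all add: corner_def mid_def)
qed

text \<open>The bound on \<open>snd w\<close> discards the neighbour above, since layer
  \<open>z\<close> will be the topmost coloured one.\<close>

lemma edge_corner:
  assumes "i < 4" "{(corner (next_domino i), z), w} \<in> edges (grid n)" "snd w \<le> z"
  shows "w = (mid i, z) \<or> w = (mid (next_domino i), z) \<or> 0 < z \<and> w = (corner (next_domino i), z - 1)"
  using assms unfolding less_4_cases
  by (cases w) (auto simp: corner_def mid_def edge_grid_iff)

lemma edge_mid:
  assumes "i < 4" "{(mid i, z), w} \<in> edges (grid n)" "snd w \<le> z"
  shows "w = (corner (next_domino i), z) \<or> w = (corner i, z) \<or> w = ((1, 1), z) \<or>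
    0 < z \<and> w = (mid i, z - 1)"
  using assms unfolding less_4_cases
  by (cases w) (auto simp: corner_def mid_def edge_grid_iff)

lemma edge_centre:
  assumes "{((1, 1), z), w} \<in> edges (grid n)" "snd w \<le> z"
  shows "(\<exists>i<4. w = (mid i, z)) \<or> 0 < z \<and> w = ((1, 1), z - 1)"
proof -
  obtain x y t where w: "w = ((x, y), t)"
    by (metis prod.exhaust)
  show ?thesis
    using assms unfolding ex_less_4 w edge_grid_iff by (elim conjE disjE) (simp_all add: mid_def)
qed

lemma obtain_other:
  assumes "card A = 2"
  shows "\<exists>x\<in>A. x \<noteq> y"
proof -
  obtain a b where "A = {a, b}" "a \<noteq> b"
    using assms by (auto simp: card_2_iff)
  then show ?thesis by auto
qed

text \<open>With \<open>p\<close> and \<open>q\<close> the colours below the corners and mids and \<open>\<gamma>\<close> the colour of the centre, one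
  of two greedy strategies works: let the mids avoid the colour below and the corners avoid their
  mids, or let the corners avoid the colour below and the mids avoid their corners. A failure of
  both would put \<open>\<gamma>\<close> below all four dominoes in incompatible positions.\<close>

lemma layer_colours:
  assumes "\<And>i. i < 4 \<Longrightarrow> card (A i) = 2 \<and> card (B i) = 2 \<and> p i \<noteq> q i"
  shows "\<exists>f g. (\<forall>i<4. f i \<in> A i \<and> g i \<in> B i \<and> f i \<noteq> g i) \<and>
    ((\<forall>i<4. g i \<noteq> q i) \<and> (\<forall>i<4. \<forall>j<4. i \<noteq> j \<longrightarrow>
        \<not> (g i = \<gamma> \<and> g j = \<gamma> \<and> p (next_domino i) = \<gamma> \<and> p (next_domino j) = \<gamma>)) \<or>
     (\<forall>i<4. f i \<noteq> p i) \<and> (\<forall>i<4. \<forall>j<4. i \<noteq> j \<longrightarrow> \<not> (q i = \<gamma> \<and> q j = \<gamma>)))"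
proof (cases "\<exists>i<4. \<exists>j<4. i \<noteq> j \<and> q i = \<gamma> \<and> q j = \<gamma>")
  case True
  then obtain i j where ij: "i < 4" "j < 4" "i \<noteq> j" "q i = \<gamma>" "q j = \<gamma>" by auto
  have "\<forall>i. \<exists>b. i < 4 \<longrightarrow> b \<in> B i \<and> b \<noteq> q i"
    using assms obtain_other by metis
  then obtain g where g: "\<And>i. i < 4 \<Longrightarrow> g i \<in> B i \<and> g i \<noteq> q i" by metis
  have "\<forall>i. \<exists>b. i < 4 \<longrightarrow> b \<in> A i \<and> b \<noteq> g i"
    using assms obtain_other by metis
  then obtain f where f: "\<And>i. i < 4 \<Longrightarrow> f i \<in> A i \<and> f i \<noteq> g i" by metis
  have "False" if h: "k < 4" "l < 4" "k \<noteq> l" "g k = \<gamma>" "g l = \<gamma>"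
    "p (next_domino k) = \<gamma>" "p (next_domino l) = \<gamma>" for k l
  proof -
    \<comment> \<open>Both \<open>{k, l}\<close> and its cyclic shift must be the complement of
      \<open>{i, j}\<close>, but no two-element subset of the 4-cycle is invariant under a shift by
      one.\<close>
    have "k \<notin> {i, j}" "l \<notin> {i, j}"
      using g[OF ij(1)] g[OF ij(2)] h(4,5) ij(4,5) by auto
    moreover have "next_domino k \<notin> {i, j}" "next_domino l \<notin> {i, j}"
      using assms[OF ij(1)] assms[OF ij(2)] h(6,7) ij(4,5) by auto
    ultimately show False
      using h(1-3) ij(1-3) unfolding less_4_cases by auto
  qed
  then show ?thesis
    using f g by (intro exI[of _ f] exI[of _ g]) auto
next
  case False
  have "\<forall>i. \<exists>b. i < 4 \<longrightarrow> b \<in> A i \<and> b \<noteq> p i"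
    using assms obtain_other by metis
  then obtain f where f: "\<And>i. i < 4 \<Longrightarrow> f i \<in> A i \<and> f i \<noteq> p i" by metis
  have "\<forall>i. \<exists>b. i < 4 \<longrightarrow> b \<in> B i \<and> b \<noteq> f i"
    using assms obtain_other by metis
  then obtain g where g: "\<And>i. i < 4 \<Longrightarrow> g i \<in> B i \<and> g i \<noteq> f i" by metis
  show ?thesis
    using f g False by (intro exI[of _ f] exI[of _ g]) metis
qed

text \<open>The other half of a domino never supports a vertex of \<open>C\<close>. So a corner
  needs the preceding mid and the corner below, a mid needs two of the next corner, the centre and
  the mid below, and the centre needs two mids. Either alternative of \<open>choice\<close> first
  excludes the centre, then the mids, then the corners.\<close>

lemma core_avoids_top_layer:
  assumes C: "core (edges (grid n)) C" "C \<subseteq> verts (grid (Suc z))" "\<And>v. v \<in> C \<Longrightarrow> c v = a"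
    and split: "\<And>i. i < 4 \<Longrightarrow> c (corner i, z) \<noteq> c (mid i, z)"
    and below: "\<And>i. i < 4 \<Longrightarrow> 0 < z \<Longrightarrow> p i = c (corner i, z - 1) \<and> q i = c (mid i, z - 1)"
    and centre: "0 < z \<Longrightarrow> c ((1, 1), z) \<noteq> c ((1, 1), z - 1)"
    and choice: "(\<forall>i<4. c (mid i, z) \<noteq> q i) \<and> (\<forall>i<4. \<forall>j<4. i \<noteq> j \<longrightarrow>
        \<not> (c (mid i, z) = c ((1, 1), z) \<and> c (mid j, z) = c ((1, 1), z) \<and>
          p (next_domino i) = c ((1, 1), z) \<and> p (next_domino j) = c ((1, 1), z))) \<or>
      (\<forall>i<4. c (corner i, z) \<noteq> p i) \<and>
      (\<forall>i<4. \<forall>j<4. i \<noteq> j \<longrightarrow> \<not> (q i = c ((1, 1), z) \<and> q j = c ((1, 1), z)))"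
  shows "C \<subseteq> verts (grid z)"
proof -
  let ?E = "edges (grid n)"
  have next_less: "next_domino i < 4" for i by simp
  have nbrs: "\<exists>x\<in>C. \<exists>y\<in>C. x \<noteq> y \<and> {v, x} \<in> ?E \<and> {v, y} \<in> ?E \<and> snd x \<le> z \<and> snd y \<le> z"
    if "v \<in> C" for v
  proof -
    obtain x y where "x \<in> C" "y \<in> C" "x \<noteq> y" "{v, x} \<in> ?E" "{v, y} \<in> ?E"
      using C(1) \<open>v \<in> C\<close> unfolding core_def by metis
    moreover have "snd w \<le> z" if "w \<in> C" for w
      using that C(2) by (auto simp: verts_grid)
    ultimately show ?thesis by blast
  qed
  have cornerC: "(mid i, z) \<in> C \<and> p (next_domino i) = a"
    if i: "i < 4" and v: "(corner (next_domino i), z) \<in> C" for i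
  proof -
    have *: "(mid (next_domino i), z) \<notin> C"
      using split[OF next_less, of i] C(3) v by metis
    from nbrs[OF v] obtain x y where xy: "x \<in> C" "y \<in> C" "x \<noteq> y"
      "{(corner (next_domino i), z), x} \<in> ?E" "{(corner (next_domino i), z), y} \<in> ?E"
      "snd x \<le> z" "snd y \<le> z" by blast
    have "(mid i, z) \<in> C" "0 < z" "(corner (next_domino i), z - 1) \<in> C"
      using edge_corner[OF i xy(4,6)] edge_corner[OF i xy(5,7)] xy(1-3) * by metis+
    then show ?thesis
      using below[OF next_less] C(3) by metis
  qed
  have midC: "(corner (next_domino i), z) \<in> C \<and> ((1, 1), z) \<in> C \<or>
      (corner (next_domino i), z) \<in> C \<and> q i = a \<or> ((1, 1), z) \<in> C \<and> q i = a"
    if i: "i < 4" and v: "(mid i, z) \<in> C" for i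
  proof -
    have *: "(corner i, z) \<notin> C"
      using split[OF i] C(3) v by metis
    from nbrs[OF v] obtain x y where xy: "x \<in> C" "y \<in> C" "x \<noteq> y"
      "{(mid i, z), x} \<in> ?E" "{(mid i, z), y} \<in> ?E" "snd x \<le> z" "snd y \<le> z" by blast
    have q: "q i = a" if "0 < z" "(mid i, z - 1) \<in> C"
      using that below[OF i] C(3) by metis
    show ?thesis
      using edge_mid[OF i xy(4,6)] edge_mid[OF i xy(5,7)] xy(1-3) * q by metis
  qed
  have centreC: "\<exists>i<4. \<exists>j<4. i \<noteq> j \<and> (mid i, z) \<in> C \<and> (mid j, z) \<in> C"
    if v: "((1, 1), z) \<in> C"
  proof -
    have *: "\<not> (0 < z \<and> ((1, 1), z - 1) \<in> C)"
      using centre C(3) v by metis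
    from nbrs[OF v] obtain x y where xy: "x \<in> C" "y \<in> C" "x \<noteq> y"
      "{((1, 1), z), x} \<in> ?E" "{((1, 1), z), y} \<in> ?E" "snd x \<le> z" "snd y \<le> z" by blast
    show ?thesis
      using edge_centre[OF xy(4,6)] edge_centre[OF xy(5,7)] xy(1-3) * by metis
  qed
  have col: "c (mid i, z) = a" if "(mid i, z) \<in> C" for i
    using C(3) that by simp
  have centre_notin: "((1, 1), z) \<notin> C"
  proof
    assume v: "((1, 1), z) \<in> C"
    then have a: "c ((1, 1), z) = a"
      using C(3) by simp
    obtain i j where ij: "i < 4" "j < 4" "i \<noteq> j" "(mid i, z) \<in> C" "(mid j, z) \<in> C"
      using centreC[OF v] by blast
    from choice show False
    proof
      assume A: "(\<forall>i<4. c (mid i, z) \<noteq> q i) \<and> (\<forall>i<4. \<forall>j<4. i \<noteq> j \<longrightarrow>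
        \<not> (c (mid i, z) = c ((1, 1), z) \<and> c (mid j, z) = c ((1, 1), z) \<and>
          p (next_domino i) = c ((1, 1), z) \<and> p (next_domino j) = c ((1, 1), z)))"
      \<comment> \<open>The mid below has another colour, so \<open>mid k\<close> must be supported
        by the next corner, which in turn needs the corner below it.\<close>
      have "p (next_domino k) = a" if "k < 4" "(mid k, z) \<in> C" for k
        using midC[OF that] cornerC[OF that(1)] A col[OF that(2)] that(1) by metis
      then show False
        using A ij a col by metis
    next
      assume B: "(\<forall>i<4. c (corner i, z) \<noteq> p i) \<and>
        (\<forall>i<4. \<forall>j<4. i \<noteq> j \<longrightarrow> \<not> (q i = c ((1, 1), z) \<and> q j = c ((1, 1), z)))"
      \<comment> \<open>No corner can be in \<open>C\<close>, since it would need the corner below;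
        so \<open>mid k\<close> relies on the mid below.\<close>
      have "q k = a" if "k < 4" "(mid k, z) \<in> C" for k
        using midC[OF that] cornerC[OF that(1)] B C(3) next_less by metis
      then show False
        using B ij a by metis
    qed
  qed
  have mid_notin: "(mid i, z) \<notin> C" if "i < 4" for i
  proof
    assume v: "(mid i, z) \<in> C"
    \<comment> \<open>Without the centre, the mid agrees with the mid below and the next corner with
      the corner below, so both alternatives of \<open>choice\<close> fail.\<close>
    then have "(corner (next_domino i), z) \<in> C" "q i = a"
      using midC[OF that] centre_notin by blast+
    moreover have "c (mid i, z) = a" "c (corner (next_domino i), z) = a" "p (next_domino i) = a"
      using v C(3) cornerC[OF that] calculation by auto
    ultimately show False
      using choice that next_less by metis
  qed
  have corner_notin: "(corner (next_domino i), z) \<notin> C" if "i < 4" for i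
    using cornerC[OF that] mid_notin[OF that] by blast
  have "((x, y), z) \<notin> C" if "x < 3" "y < 3" for x y
    using square_cases[OF that] centre_notin mid_notin corner_notin by metis
  then show ?thesis
    using C(2) by (fastforce simp: verts_grid less_Suc_eq)
qed

section \<open>Sizes of colour classes for lists of size two\<close>

definition dominoes_split :: "nat \<Rightarrow> ((nat \<times> nat) \<times> nat \<Rightarrow> 'c) \<Rightarrow> bool" where
  "dominoes_split n c \<longleftrightarrow> (\<forall>z<n. \<forall>i<4. c (corner i, z) \<noteq> c (mid i, z))"

definition centres_alternate :: "nat \<Rightarrow> ((nat \<times> nat) \<times> nat \<Rightarrow> 'c) \<Rightarrow> bool" where
  "centres_alternate n c \<longleftrightarrow> (\<forall>z. Suc z < n \<longrightarrow> c ((1, 1), Suc z) \<noteq> c ((1, 1), z))"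

text \<open>Two consecutive positions contain a given colour at most once, so the induction advances
  by two.\<close>

lemma card_level_set_alternating:
  fixes f :: "nat \<Rightarrow> 'c"
  assumes "\<And>z. Suc z < n \<Longrightarrow> f (Suc z) \<noteq> f z"
  shows "card {z. z < n \<and> f z = a} \<le> (n + 1) div 2"
  using assms
proof (induction n rule: induct_nat_012)
  case 1
  then show ?case by (auto simp: card_le_Suc0_iff_eq)
next
  case (ge2 n)
  have eq: "{z. z < Suc (Suc n) \<and> f z = a} = {z. z < n \<and> f z = a} \<union> {z \<in> {n, Suc n}. f z = a}"
    by (auto simp: less_Suc_eq)
  have "card {z \<in> {n, Suc n}. f z = a} \<le> Suc 0"
    using ge2.prems[of n] by (auto simp: card_le_Suc0_iff_eq)
  moreover have "card {z. z < n \<and> f z = a} \<le> (n + 1) div 2"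
    using ge2 by auto
  ultimately show ?case
    unfolding eq using card_Un_le[of "{z. z < n \<and> f z = a}" "{z \<in> {n, Suc n}. f z = a}"] by simp
qed simp

text \<open>Each of the \<open>4 * n\<close> dominoes contributes at most one vertex to a class, and
  the alternating column of centres at most half of its vertices, rounded up.\<close>

lemma card_class_dominoes:
  assumes "dominoes_split n c" "centres_alternate n c"
  shows "card {v \<in> verts (grid n). c v = a} \<le> 4 * n + (n + 1) div 2"
proof -
  define D where "D z i = {v \<in> {(corner i, z), (mid i, z)}. c v = a}" for z i
  define M where "M = {z. z < n \<and> c ((1, 1), z) = a}"
  have fin: "finite (D z i)" for z i
    by (simp add: D_def)
  have "{v \<in> verts (grid n). c v = a} \<subseteq> (\<Union>z<n. \<Union>i<4. D z i) \<union> (\<lambda>z. ((1, 1), z)) ` M"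
  proof
    fix v assume "v \<in> {v \<in> verts (grid n). c v = a}"
    then obtain x y z where v: "v = ((x, y), z)" "x < 3" "y < 3" "z < n" "c v = a"
      by (auto simp: verts_grid)
    from square_cases[OF v(2,3)] show "v \<in> (\<Union>z<n. \<Union>i<4. D z i) \<union> (\<lambda>z. ((1, 1), z)) ` M"
    proof (elim disjE exE conjE)
      fix i :: nat assume i: "i < 4" "(x, y) = corner (next_domino i)"
      then have "v \<in> D z (next_domino i)" "next_domino i < 4"
        using v by (auto simp: D_def)
      then show ?thesis using v(4) by blast
    next
      fix i :: nat assume i: "i < 4" "(x, y) = mid i"
      then have "v \<in> D z i"
        using v by (auto simp: D_def)
      then show ?thesis using v(4) i by blast
    qed (use v in \<open>auto simp: M_def\<close>)
  qed
  then have "card {v \<in> verts (grid n). c v = a} \<le>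
      card ((\<Union>z<n. \<Union>i<4. D z i) \<union> (\<lambda>z. ((1, 1), z)) ` M)"
    using fin by (intro card_mono) (auto simp: M_def)
  also have "\<dots> \<le> card (\<Union>z<n. \<Union>i<4. D z i) + card ((\<lambda>z. ((1 :: nat, 1 :: nat), z)) ` M)"
    by (rule card_Un_le)
  also have "\<dots> \<le> 4 * n + (n + 1) div 2"
  proof (rule add_mono)
    have one: "card (D z i) \<le> 1" if "z < n" "i < 4" for z i
    proof -
      have "c (corner i, z) \<noteq> c (mid i, z)"
        using assms(1) that by (simp add: dominoes_split_def)
      then have "D z i \<subseteq> {if c (corner i, z) = a then (corner i, z) else (mid i, z)}"
        unfolding D_def by auto
      from card_mono[OF _ this] show ?thesis
        by simp
    qed
    have "card (\<Union>i<4. D z i) \<le> 4" if "z < n" for z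
    proof -
      have "card (\<Union>i<4. D z i) \<le> (\<Sum>i<4. card (D z i))"
        by (rule card_UN_le) simp
      also have "\<dots> \<le> 4"
        using sum_bounded_above[of "{..<4}" "\<lambda>i. card (D z i)" 1] one that by simp
      finally show ?thesis .
    qed
    then have "(\<Sum>z<n. card (\<Union>i<4. D z i)) \<le> 4 * n"
      using sum_bounded_above[of "{..<n}" "\<lambda>z. card (\<Union>i<4. D z i)" 4] by (simp add: mult.commute)
    then show "card (\<Union>z<n. \<Union>i<4. D z i) \<le> 4 * n"
      using card_UN_le[of "{..<n}" "\<lambda>z. \<Union>i<4. D z i"] by simp
    have "card ((\<lambda>z. ((1 :: nat, 1 :: nat), z)) ` M) \<le> card M"
      by (rule card_image_le) (simp add: M_def)
    also have "\<dots> \<le> (n + 1) div 2"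
      unfolding M_def using assms(2)
      by (intro card_level_set_alternating) (simp add: centres_alternate_def)
    finally show "card ((\<lambda>z. ((1 :: nat, 1 :: nat), z)) ` M) \<le> (n + 1) div 2" .
  qed
  finally show ?thesis .
qed

section \<open>Layer-by-layer construction for lists of size two\<close>

lemma domino_colouring:
  assumes L: "uniform_list_assignment 2 (grid n) L"
  shows "z \<le> n \<Longrightarrow> \<exists>c. (\<forall>v\<in>verts (grid z). c v \<in> L v) \<and> dominoes_split z c \<and>
    centres_alternate z c \<and> forest_colouring (edges (grid n)) (verts (grid z)) c"
proof (induction z)
  case 0
  then show ?case
    by (auto simp: verts_grid dominoes_split_def centres_alternate_def forest_colouring_def core_def)
next
  case (Suc z)
  then obtain c where c: "\<forall>v\<in>verts (grid z). c v \<in> L v" "dominoes_split z c"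
    "centres_alternate z c" "forest_colouring (edges (grid n)) (verts (grid z)) c"
    by auto
  have z: "z < n" using Suc.prems by simp
  have L2: "card (L ((x, y), z)) = 2" if "x < 3" "y < 3" for x y
    using L z that by (simp add: uniform_list_assignment_def verts_grid)
  have L2': "card (L (corner i, z)) = 2 \<and> card (L (mid i, z)) = 2" if "i < 4" for i
    using that unfolding less_4_cases by (auto simp: corner_def mid_def L2)
  obtain \<alpha> \<beta> where "L ((1, 1), z) = {\<alpha>, \<beta>}" and \<alpha>\<beta>: "\<alpha> \<noteq> \<beta>"
    using L2[of 1 1] by (auto simp: card_2_iff)
  \<comment> \<open>The bottom layer has nothing below it; the distinct defaults
    \<open>\<alpha>\<close> and \<open>\<beta>\<close> merely keep \<open>p i\<close> and
    \<open>q i\<close> different, as \<open>layer_colours\<close> demands.\<close>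
  define p where "p i = (if z = 0 then \<alpha> else c (corner i, z - 1))" for i
  define q where "q i = (if z = 0 then \<beta> else c (mid i, z - 1))" for i
  have pq: "p i \<noteq> q i" if "i < 4" for i
    using that c(2) \<alpha>\<beta> by (simp add: p_def q_def dominoes_split_def)
  \<comment> \<open>For \<open>z = 0\<close> this avoids an arbitrary value of \<open>c\<close>,
    which does no harm.\<close>
  obtain \<gamma> where \<gamma>: "\<gamma> \<in> L ((1, 1), z)" "\<gamma> \<noteq> c ((1, 1), z - 1)"
    using obtain_other[OF L2[of 1 1], of "c ((1, 1), z - 1)"] by auto
  obtain f g where fg: "\<forall>i<4. f i \<in> L (corner i, z) \<and> g i \<in> L (mid i, z) \<and> f i \<noteq> g i"
    and choice: "(\<forall>i<4. g i \<noteq> q i) \<and> (\<forall>i<4. \<forall>j<4. i \<noteq> j \<longrightarrow>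
        \<not> (g i = \<gamma> \<and> g j = \<gamma> \<and> p (next_domino i) = \<gamma> \<and> p (next_domino j) = \<gamma>)) \<or>
      (\<forall>i<4. f i \<noteq> p i) \<and> (\<forall>i<4. \<forall>j<4. i \<noteq> j \<longrightarrow> \<not> (q i = \<gamma> \<and> q j = \<gamma>))"
    using layer_colours[of "\<lambda>i. L (corner i, z)" "\<lambda>i. L (mid i, z)" p q \<gamma>] L2' pq by blast
  \<comment> \<open>Only layer \<open>z\<close> is recoloured; \<open>THE\<close> recovers the index
    of the domino containing the vertex.\<close>
  define c' where "c' v = (if snd v \<noteq> z then c v else if fst v = (1, 1) then \<gamma>
    else if \<exists>i<4. fst v = corner i then f (THE i. i < 4 \<and> fst v = corner i)
    else g (THE i. i < 4 \<and> fst v = mid i))" for v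
  have ne: "corner i \<noteq> (1, 1)" "mid i \<noteq> (1, 1)" if "i < 4" for i
    using that unfolding less_4_cases by (auto simp: corner_def mid_def)
  have ne': "mid i \<noteq> corner j" if "i < 4" "j < 4" for i j
    using that unfolding less_4_cases by (auto simp: corner_def mid_def)
  have inj: "corner i = corner j \<longleftrightarrow> i = j" "mid i = mid j \<longleftrightarrow> i = j" if "i < 4" "j < 4" for i j
    using that unfolding less_4_cases by (auto simp: corner_def mid_def)
  have c'_corner: "c' (corner i, z) = f i" if i: "i < 4" for i
  proof -
    have "(THE j. j < 4 \<and> corner i = corner j) = i"
      using i inj by (intro the_equality) auto
    then show ?thesis using i ne by (auto simp: c'_def)
  qed
  have c'_mid: "c' (mid i, z) = g i" if i: "i < 4" for i
  proof -
    have "(THE j. j < 4 \<and> mid i = mid j) = i"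
      using i inj by (intro the_equality) auto
    then show ?thesis using i ne ne' by (auto simp: c'_def)
  qed
  have c'_centre: "c' ((1, 1), z) = \<gamma>"
    by (simp add: c'_def)
  have c'_old: "c' (u, t) = c (u, t)" if "t \<noteq> z" for u t
    using that by (simp add: c'_def)
  have old: "c' v = c v" if "v \<in> verts (grid z)" for v
    using that by (auto simp: c'_def verts_grid)
  have "c' v \<in> L v" if v: "v \<in> verts (grid (Suc z))" for v
  proof (cases "v \<in> verts (grid z)")
    case True
    then show ?thesis using c(1) old by simp
  next
    case False
    then obtain x y where xy: "v = ((x, y), z)" "x < 3" "y < 3"
      using v by (auto simp: verts_grid less_Suc_eq)
    from square_cases[OF xy(2,3)] show ?thesis
    proof (elim disjE exE conjE)
      fix i :: nat assume "i < 4" "(x, y) = corner (next_domino i)"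
      then show ?thesis
        using fg c'_corner[of "next_domino i"] by (simp add: xy(1))
    next
      fix i :: nat assume "i < 4" "(x, y) = mid i"
      then show ?thesis
        using fg c'_mid[of i] by (simp add: xy(1))
    qed (simp add: xy(1) c'_centre[simplified] \<gamma>[simplified])
  qed
  moreover have split: "dominoes_split (Suc z) c'"
    using c(2) fg by (auto simp: dominoes_split_def less_Suc_eq c'_corner c'_mid c'_old)
  moreover have alt: "centres_alternate (Suc z) c'"
    unfolding centres_alternate_def
  proof (intro allI impI)
    fix t assume "Suc t < Suc z"
    then consider "Suc t < z" | "Suc t = z" by linarith
    then show "c' ((1, 1), Suc t) \<noteq> c' ((1, 1), t)"
    proof cases
      case 1
      then show ?thesis using c(3) by (simp add: centres_alternate_def c'_old)
    next
      case 2
      then show ?thesis using \<gamma>(2) c'_centre c'_old[of t "(1, 1)"] by auto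
    qed
  qed
  moreover have "forest_colouring (edges (grid n)) (verts (grid (Suc z))) c'"
    unfolding forest_colouring_def
  proof (intro allI impI notI)
    fix C a
    assume C: "C \<subseteq> verts (grid (Suc z))" "core (edges (grid n)) C" "\<forall>v\<in>C. c' v = a"
    have "C \<subseteq> verts (grid z)"
    proof (rule core_avoids_top_layer[of n C z c' a p q])
      show "c' (corner i, z) \<noteq> c' (mid i, z)" if "i < 4" for i
        using split that by (simp add: dominoes_split_def)
      show "p i = c' (corner i, z - 1) \<and> q i = c' (mid i, z - 1)" if "i < 4" "0 < z" for i
        using that by (simp add: p_def q_def c'_old)
      show "c' ((1, 1), z) \<noteq> c' ((1, 1), z - 1)" if "0 < z"
        using that \<gamma>(2) c'_centre c'_old[of "z - 1" "(1, 1)"] by simp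
    qed (use C choice in \<open>simp_all add: c'_corner c'_mid c'_centre[simplified]\<close>)
    moreover from this have "\<forall>v\<in>C. c v = a"
      using C(3) old by (metis subsetD)
    ultimately show False
      using c(4) C(2) unfolding forest_colouring_def by metis
  qed
  ultimately show ?case by blast
qed

lemma capped_colouring_2:
  assumes "uniform_list_assignment 2 (grid n) L"
  shows "\<exists>c. capped_colouring (edges (grid n)) L (verts (grid n)) (4 * n + (n + 1) div 2) c"
proof -
  obtain c where c: "\<forall>v\<in>verts (grid n). c v \<in> L v" "dominoes_split n c" "centres_alternate n c"
    "forest_colouring (edges (grid n)) (verts (grid n)) c"
    using domino_colouring[OF assms order_refl] by blast
  then have "capped_colouring (edges (grid n)) L (verts (grid n)) (4 * n + (n + 1) div 2) c"
    unfolding capped_colouring_def using card_class_dominoes[OF c(2,3)] by blast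
  then show ?thesis by (intro exI[of _ c])
qed

section \<open>Matching the three caps with the ceiling in equitability\<close>

theorem theorem8:
  fixes n\<^sub>3 k :: nat
  assumes "k \<ge> 2"
  shows "equitably_list_arborable TYPE('c) k (path_graph 3 \<box> path_graph 3 \<box> path_graph n\<^sub>3)"
proof -
  consider "k = 2" | "k = 3" | "4 \<le> k"
    using assms by linarith
  then have "equitably_list_arborable TYPE('c) k (grid n\<^sub>3)"
  proof cases
    case 1
    show ?thesis
      unfolding 1
    proof (rule equitably_list_arborableI[OF capped_colouring_2])
      show "int (4 * n\<^sub>3 + (n\<^sub>3 + 1) div 2) \<le> \<lceil>real (card (verts (grid n\<^sub>3))) / real 2\<rceil>"
        unfolding card_verts_grid by linarith
    qed
  next
    case 2
    show ?thesis
      unfolding 2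
    proof (rule equitably_list_arborableI[OF capped_colouring_3[OF _ order_refl]])
      show "int (3 * n\<^sub>3) \<le> \<lceil>real (card (verts (grid n\<^sub>3))) / real 3\<rceil>"
        unfolding card_verts_grid by linarith
    qed
  next
    case 3
    have "int ((9 * n\<^sub>3 + k - 1) div k) \<le> \<lceil>real (card (verts (grid n\<^sub>3))) / real k\<rceil>"
    proof -
      \<comment> \<open>It suffices to show \<open>m - 1 < 9 * n\<^sub>3 / k\<close> over the reals,
        since \<open>m\<close> is an integer.\<close>
      define m where "m = (9 * n\<^sub>3 + k - 1) div k"
      have "m * k \<le> 9 * n\<^sub>3 + k - 1"
        by (simp add: m_def)
      then have "m * k < 9 * n\<^sub>3 + k"
        using 3 by linarith
      then have "real m * real k < real (9 * n\<^sub>3) + real k"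
        by (metis of_nat_add of_nat_less_iff of_nat_mult)
      then have "real m - 1 < real (9 * n\<^sub>3) / real k"
        using 3 by (simp add: field_simps)
      then show ?thesis
        unfolding card_verts_grid m_def[symmetric] by linarith
    qed
    then show ?thesis
      using capped_colouring_ge_4[OF _ 3 order_refl]
      by (intro equitably_list_arborableI) (simp_all add: verts_grid_lex)
  qed
  then show ?thesis
    by (simp add: grid_def)
qed

end
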